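(* Let $d\ge 2$, let $n_1,\dots,n_d$ be positive integers, let $r_1,\dots,r_{d-1}\ge 0$ be integers, and let $\mathcal{M}=\mathcal{M}_{\leq(r_{1},\dots,r_{d-1})}^{n_{1}\times\dots\times n_{d}}$. Then for every $A\in\mathcal{M}$ the tangent cone $T_A\mathcal{M}$ equals the set of all first derivatives of analytic arcs in $\mathcal{M}$ starting at $A$: $$T_A\mathcal{M}=\left\{v\in\mathbb{R}^{n_1\times\dots\times n_d}:\ \exists\,\varepsilon>0,\ \gamma:[0,\varepsilon]\rightarrow\mathcal{M}\text{ analytic with }\gamma(0)=A,\ \dot{\gamma}(0)=v\right\}.$$
   Context: $A^{(n_1\dots n_i)\times(n_{i+1}\dots n_d)}$ denotes the matricization of $A\in\mathbb{R}^{n_1\times\dots\times n_d}$ obtained by grouping the first $i$ indices as row index and the remaining ones as column index (lexicographic order). TT variety: $\mathcal{M}_{\leq(r_{1},\dots,r_{d-1})}^{n_{1}\times\dots\times n_{d}}=\{A\in\mathbb{R}^{n_{1}\times\dots\times n_{d}}:\forall i:\operatorname{rank}(A^{(n_{1}\dots n_{i})\times(n_{i+1}\dots n_{d})})\leq r_{i}\}$. Tangent cone (Bouligand contingent cone) of $\mathcal{M}\subset\mathbb{R}^N$ at $A\in\mathcal{M}$: $T_{A}\mathcal{M}=\{\xi\in\mathbb{R}^{N}:\exists(x_{n})\subset\mathcal{M},(a_{n})\subset\mathbb{R}^{+}\text{ s.t. }x_{n}\rightarrow A,\ a_{n}(x_{n}-A)\rightarrow\xi\}$. *)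

theory Defs
  imports "HOL-Analysis.Function_Topology" "Jordan_Normal_Form.DL_Rank"
begin

text \<open>
  A multi-index for mode sizes \<open>ns = [n\<^sub>1, \<dots>, n\<^sub>d]\<close> is a list of length \<open>d\<close> whose \<open>k\<close>-th entry ranges
  over \<open>0, \<dots>, n\<^sub>k - 1\<close>. A real \<open>n\<^sub>1 \<times> \<dots> \<times> n\<^sub>d\<close> tensor is a function on all lists that vanishes off
  the multi-indices, so that the tensors form a copy of the finite-dimensional space
  \<open>\<real>\<^bsup>n\<^sub>1 \<times> \<dots> \<times> n\<^sub>d\<^esup>\<close>. On it, the topology of pointwise convergence on the function type is the
  Euclidean one.
\<close>

type_synonym tensor = "nat list \<Rightarrow> real"

definition multi_indices :: "nat list \<Rightarrow> nat list set" where
  "multi_indices ns = {is. list_all2 (<) is ns}"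

definition tensors :: "nat list \<Rightarrow> tensor set" where
  "tensors ns = {A. \<forall>is. is \<notin> multi_indices ns \<longrightarrow> A is = 0}"

text \<open>
  \<open>product_lists\<close> varies the last entry fastest, i.e. it enumerates in lexicographic order.
\<close>

definition lex_indices :: "nat list \<Rightarrow> nat list list" where
  "lex_indices ns = product_lists (map (\<lambda>n. [0..<n]) ns)"

lemma set_lex_indices: "set (lex_indices ns) = multi_indices ns"
  by (auto simp: lex_indices_def multi_indices_def product_lists_set list_all2_conv_all_nth)

lemma distinct_lex_indices: "distinct (lex_indices ns)"
  unfolding lex_indices_def by (rule distinct_product_lists) auto

definition matricization :: "nat list \<Rightarrow> nat \<Rightarrow> tensor \<Rightarrow> real mat" where
  "matricization ns i A =
     (let rows = lex_indices (take i ns); cols = lex_indices (drop i ns)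
      in mat (length rows) (length cols) (\<lambda>(p, q). A (rows ! p @ cols ! q)))"

definition mat_rank :: "real mat \<Rightarrow> nat" where
  "mat_rank M = vec_space.rank (dim_row M) M"

text \<open>Only the values \<open>r 1, \<dots>, r (d - 1)\<close> of the rank bound are relevant.\<close>

definition TT_variety :: "nat list \<Rightarrow> (nat \<Rightarrow> nat) \<Rightarrow> tensor set" where
  "TT_variety ns r =
     {A \<in> tensors ns. \<forall>i\<in>{1..<length ns}. mat_rank (matricization ns i A) \<le> r i}"

definition tangent_cone :: "nat list \<Rightarrow> tensor set \<Rightarrow> tensor \<Rightarrow> tensor set" where
  "tangent_cone ns M A =
     {\<xi> \<in> tensors ns. \<exists>(x :: nat \<Rightarrow> tensor) (a :: nat \<Rightarrow> real).
        (\<forall>k. x k \<in> M) \<and> (\<forall>k. a k > 0) \<and>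
        x \<longlonglongrightarrow> A \<and> (\<lambda>k is. a k * (x k is - A is)) \<longlonglongrightarrow> \<xi>}"

text \<open>
  Real analyticity on a set \<open>S\<close>: the function is locally given on \<open>S\<close> by convergent power series.
  On a nondegenerate interval \<open>{0..\<epsilon>}\<close> this is the same as having a real analytic extension to an
  open neighbourhood; at the end points, convergence on one side forces a positive radius of
  convergence.
\<close>

definition real_analytic_on :: "(real \<Rightarrow> real) \<Rightarrow> real set \<Rightarrow> bool" where
  "real_analytic_on f S \<longleftrightarrow>
     (\<forall>t\<^sub>0\<in>S. \<exists>\<rho>>0. \<exists>c :: nat \<Rightarrow> real.
        \<forall>t\<in>S. \<bar>t - t\<^sub>0\<bar> < \<rho> \<longrightarrow> (\<lambda>k. c k * (t - t\<^sub>0) ^ k) sums f t)"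

text \<open>
  Analyticity and derivatives of tensor-valued curves are taken entrywise. The derivative at the
  left end point is one-sided.
\<close>

definition analytic_arc_in :: "tensor set \<Rightarrow> real \<Rightarrow> (real \<Rightarrow> tensor) \<Rightarrow> bool" where
  "analytic_arc_in M \<epsilon> \<gamma> \<longleftrightarrow>
     \<gamma> ` {0..\<epsilon>} \<subseteq> M \<and> (\<forall>is. real_analytic_on (\<lambda>t. \<gamma> t is) {0..\<epsilon>})"

definition has_initial_velocity :: "(real \<Rightarrow> tensor) \<Rightarrow> real \<Rightarrow> tensor \<Rightarrow> bool" where
  "has_initial_velocity \<gamma> \<epsilon> v \<longleftrightarrow>
     (\<forall>is. ((\<lambda>t. \<gamma> t is) has_real_derivative v is) (at 0 within {0..\<epsilon>}))"

end

theory Submission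
  imports Defs
begin

text \<open>
  Let \<open>\<xi>\<close> be the limit of \<open>a\<^sub>n (x\<^sub>n - A)\<close>. For each \<open>i\<close>, orthogonal projections of rank at most \<open>r\<^sub>i\<close>
  that fix the columns of the \<open>i\<close>-th matricization of \<open>x\<^sub>n\<close> subconverge to some \<open>\<Pi>\<^sub>i\<close>, and since row
  spaces are closed there is a matrix \<open>K\<^sub>i\<close> with \<open>\<Pi>\<^sub>i A = A\<close> and \<open>\<Pi>\<^sub>i \<xi> + K\<^sub>i A = \<xi>\<close>. The operator
  \<open>S\<^sub>i(t) = (1 + t K\<^sub>i) \<Pi>\<^sub>i\<close>, acting on the first \<open>i\<close> modes, has rank at most \<open>r\<^sub>i\<close> and maps
  \<open>A + t \<xi> + O(t\<^sup>2)\<close> to a tensor of the same form. As an operator on the first \<open>j \<le> i\<close> modes does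
  not increase the rank of the \<open>i\<close>-th matricization, \<open>S\<^sub>1(t) \<cdots> S\<^sub>d\<^sub>-\<^sub>1(t) (A + t \<xi>)\<close> is a polynomial
  arc in the variety with initial velocity \<open>\<xi>\<close>.
\<close>

section \<open>Rank as the length of a factorization\<close>

text \<open>The length is exactly \<open>r\<close>, but terms may vanish, so this bounds the rank
  from above. Rows and columns are indexed by arbitrary sets, so that multi-indices can serve
  directly, without an enumeration.\<close>

definition rank_at_most :: "nat \<Rightarrow> 'a set \<Rightarrow> 'b set \<Rightarrow> ('a \<Rightarrow> 'b \<Rightarrow> real) \<Rightarrow> bool" where
  "rank_at_most r I J f \<longleftrightarrow> (\<exists>b c. \<forall>i\<in>I. \<forall>j\<in>J. f i j = (\<Sum>k<r. b k i * c k j))"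

text \<open>Number the elements of \<open>S\<close> and pad the sum with zero terms up to length
  \<open>r\<close>.\<close>

lemma rank_at_most_card:
  assumes "finite S" and "card S \<le> r"
    and f: "\<And>i j. i \<in> I \<Longrightarrow> j \<in> J \<Longrightarrow> f i j = (\<Sum>s\<in>S. b s i * c s j)"
  shows "rank_at_most r I J f"
proof -
  obtain h where h: "bij_betw h {..<card S} S"
    using ex_bij_betw_nat_finite[OF \<open>finite S\<close>] by (auto simp: atLeast0LessThan)
  have "f i j = (\<Sum>k<r. (if k < card S then b (h k) i else 0) * c (h k) j)"
    if "i \<in> I" "j \<in> J" for i j
  proof -
    have "f i j = (\<Sum>k<card S. b (h k) i * c (h k) j)"
      unfolding f[OF that] by (rule sum.reindex_bij_betw[OF h, symmetric])
    also have "\<dots> = (\<Sum>k<r. (if k < card S then b (h k) i else 0) * c (h k) j)"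
      using \<open>card S \<le> r\<close> by (intro sum.mono_neutral_cong_left) auto
    finally show ?thesis .
  qed
  then show ?thesis unfolding rank_at_most_def
    by (intro exI[of _ "\<lambda>k i. if k < card S then b (h k) i else 0"] exI[of _ "\<lambda>k. c (h k)"]) blast
qed

text \<open>A column outside the span of a maximal independent set of columns could be added to it,
  so such a set is a basis of the column space, and its size is the rank.\<close>

lemma (in vec_space) maximal_indpt_cols:
  assumes "A \<in> carrier_mat n nc"
  obtains S where "card S = rank A" "S \<subseteq> set (cols A)" "lin_indpt S" "set (cols A) \<subseteq> span S"
proof -
  have C: "set (cols A) \<subseteq> carrier_vec n" using cols_dim assms by blast
  obtain S where S: "maximal S (\<lambda>T. T \<subseteq> set (cols A) \<and> lin_indpt T)"
    using maximal_exists[of "(\<lambda>T. T \<subseteq> set (cols A) \<and> lin_indpt T)" "card (set (cols A))" "{}"]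
    by (meson List.finite_set card_mono empty_iff empty_subsetI finite_lin_indpt2 rev_finite_subset)
  then have SC: "S \<subseteq> set (cols A)" and li: "lin_indpt S"
    by (auto simp: maximal_def)
  have "s \<in> span S" if s: "s \<in> set (cols A)" for s
  proof (cases "s \<in> S")
    case True
    then show ?thesis using in_own_span SC C by blast
  next
    case False
    show ?thesis
    proof (rule ccontr)
      assume "s \<notin> span S"
      then have "lin_indpt (S \<union> {s})"
        using lin_dep_iff_in_span[of S s] SC C s False li by auto
      then show False
        using S s SC False unfolding maximal_def by (metis Un_insert_right insert_iff insert_subset
            subset_insertI sup_bot.right_neutral)
    qed
  qed
  then have "set (cols A) \<subseteq> span S" by blast
  then show ?thesis using that[OF rank_card_indpt[OF assms S, symmetric] SC li] by blast
qed

text \<open>Coordinates with respect to a basis \<open>S\<close> of columns give a factorization of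
  length \<open>rank M\<close>. Conversely, the left factors of a factorization are at most
  \<open>r\<close> vectors whose span contains the independent set \<open>S\<close>, and Steinitz
  exchange bounds its size.\<close>

lemma mat_rank_le_iff:
  "mat_rank M \<le> r \<longleftrightarrow> rank_at_most r {..<dim_row M} {..<dim_col M} (\<lambda>i j. M $$ (i, j))"
proof -
  interpret vec_space "TYPE(real)" "dim_row M" .
  have M: "M \<in> carrier_mat (dim_row M) (dim_col M)" by simp
  obtain S where S: "card S = rank M" "S \<subseteq> set (cols M)" "lin_indpt S" "set (cols M) \<subseteq> span S"
    by (rule maximal_indpt_cols[OF M])
  have C: "set (cols M) \<subseteq> carrier_vec (dim_row M)" using cols_dim by blast
  have fin: "finite S" using S(2) finite_subset by blast
  have SC: "S \<subseteq> carrier_vec (dim_row M)" using S(2) C by blast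
  show ?thesis unfolding mat_rank_def
  proof
    assume le: "rank M \<le> r"
    have "\<exists>a. col M j = lincomb a S" if "j < dim_col M" for j
    proof -
      have "col M j \<in> span S" using that S(4) by (auto simp: cols_def)
      then show ?thesis using finite_in_span[OF fin SC, of "col M j"] by (auto intro: sym)
    qed
    then obtain a where a: "\<And>j. j < dim_col M \<Longrightarrow> col M j = lincomb (a j) S" by metis
    show "rank_at_most r {..<dim_row M} {..<dim_col M} (\<lambda>i j. M $$ (i, j))"
    proof (rule rank_at_most_card[OF fin])
      show "card S \<le> r" using le S by simp
      fix i j assume ij: "i \<in> {..<dim_row M}" "j \<in> {..<dim_col M}"
      then have "M $$ (i, j) = col M j $ i" by simp
      also have "\<dots> = (\<Sum>s\<in>S. s $ i * a j s)"
        using ij a[of j] lincomb_index[OF _ SC, of i "a j"] by (auto simp: mult.commute)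
      finally show "M $$ (i, j) = (\<Sum>s\<in>S. s $ i * a j s)" .
    qed
  next
    assume "rank_at_most r {..<dim_row M} {..<dim_col M} (\<lambda>i j. M $$ (i, j))"
    then obtain b c where bc:
      "\<And>i j. i < dim_row M \<Longrightarrow> j < dim_col M \<Longrightarrow> M $$ (i, j) = (\<Sum>k<r. b k i * c k j)"
      unfolding rank_at_most_def by auto
    define B where "B = mat (dim_row M) r (\<lambda>(i, k). b k i)"
    have B: "B \<in> carrier_mat (dim_row M) r" by (simp add: B_def)
    have BC: "set (cols B) \<subseteq> carrier_vec (dim_row M)" using cols_dim[of B] B by (simp add: B_def)
    have "col M j \<in> span (set (cols B))" if j: "j < dim_col M" for j
    proof -
      have "col M j = B *\<^sub>v vec r (\<lambda>k. c k j)"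
        using j by (intro eq_vecI) (auto simp: B_def scalar_prod_def bc atLeast0LessThan)
      then show ?thesis
        using col_space_eq[OF B] unfolding col_space_def
        by (smt (verit) B carrier_matD(1) carrier_matD(2) col_dim mem_Collect_eq vec_carrier)
    qed
    then have "S \<subseteq> span (set (cols B))" using S(2) by (auto simp: cols_def)
    then have "card S \<le> card (set (cols B))"
      using replacement[OF fin _ _ S(3), of "set (cols B)"] BC by force
    also have "\<dots> \<le> r"
      using card_length[of "cols B"] B by (simp add: B_def)
    finally show "rank M \<le> r" using S by simp
  qed
qed

lemma rank_at_most_image:
  assumes g: "inj_on g I" and h: "inj_on h J"
  shows "rank_at_most r (g ` I) (h ` J) f \<longleftrightarrow> rank_at_most r I J (\<lambda>i j. f (g i) (h j))"
proof
  assume "rank_at_most r (g ` I) (h ` J) f"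
  then obtain b c where "\<forall>p\<in>g ` I. \<forall>q\<in>h ` J. f p q = (\<Sum>k<r. b k p * c k q)"
    unfolding rank_at_most_def by blast
  then show "rank_at_most r I J (\<lambda>i j. f (g i) (h j))" unfolding rank_at_most_def
    by (intro exI[of _ "\<lambda>k i. b k (g i)"] exI[of _ "\<lambda>k j. c k (h j)"]) blast
next
  assume "rank_at_most r I J (\<lambda>i j. f (g i) (h j))"
  then obtain b c where "\<forall>i\<in>I. \<forall>j\<in>J. f (g i) (h j) = (\<Sum>k<r. b k i * c k j)"
    unfolding rank_at_most_def by blast
  then show "rank_at_most r (g ` I) (h ` J) f" unfolding rank_at_most_def
    by (intro exI[of _ "\<lambda>k p. b k (the_inv_into I g p)"] exI[of _ "\<lambda>k q. c k (the_inv_into J h q)"])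
      (auto simp: the_inv_into_f_f[OF g] the_inv_into_f_f[OF h])
qed

section \<open>Multi-indices, and the variety in terms of factorizations\<close>

lemma finite_multi_indices [simp]: "finite (multi_indices ns)"
  unfolding set_lex_indices[symmetric] by simp

lemma multi_indices_split:
  "is \<in> multi_indices ns \<longleftrightarrow>
     take i is \<in> multi_indices (take i ns) \<and> drop i is \<in> multi_indices (drop i ns)"
  unfolding multi_indices_def mem_Collect_eq
  by (metis append_take_drop_id list_all2_appendI list_all2_dropI list_all2_takeI)

lemma append_in_multi_indices:
  assumes "p \<in> multi_indices (take i ns)" and "q \<in> multi_indices (drop i ns)"
  shows "p @ q \<in> multi_indices ns"
  using assms list_all2_appendI[of "(<)" p "take i ns" q "drop i ns"]
  by (simp add: multi_indices_def)

lemma length_multi_indices: "is \<in> multi_indices ns \<Longrightarrow> length is = length ns"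
  by (auto simp: multi_indices_def list_all2_lengthD)

abbreviation TT_rank_at_most :: "nat list \<Rightarrow> nat \<Rightarrow> nat \<Rightarrow> tensor \<Rightarrow> bool" where
  "TT_rank_at_most ns i r A \<equiv>
     rank_at_most r (multi_indices (take i ns)) (multi_indices (drop i ns)) (\<lambda>p q. A (p @ q))"

text \<open>The lexicographic lists enumerate the row and column multi-indices bijectively, and a
  bijective relabelling of rows and columns preserves factorizations.\<close>

lemma mat_rank_matricization_le_iff:
  "mat_rank (matricization ns i A) \<le> r \<longleftrightarrow> TT_rank_at_most ns i r A"
proof -
  have inj: "inj_on ((!) (lex_indices ms)) {..<length (lex_indices ms)}"
    and im: "(!) (lex_indices ms) ` {..<length (lex_indices ms)} = multi_indices ms" for ms
    using distinct_lex_indices[of ms]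
    by (auto simp: inj_on_def nth_eq_iff_index_eq set_lex_indices[symmetric] set_conv_nth)
  have "mat_rank (matricization ns i A) \<le> r \<longleftrightarrow>
      rank_at_most r {..<length (lex_indices (take i ns))} {..<length (lex_indices (drop i ns))}
        (\<lambda>p q. A (lex_indices (take i ns) ! p @ lex_indices (drop i ns) ! q))"
    unfolding mat_rank_le_iff by (auto simp: matricization_def Let_def rank_at_most_def)
  also have "\<dots> \<longleftrightarrow> TT_rank_at_most ns i r A"
    using rank_at_most_image[OF inj[of "take i ns"] inj[of "drop i ns"], of r "\<lambda>p q. A (p @ q)"]
    unfolding im by simp
  finally show ?thesis .
qed

lemma TT_variety_iff:
  "A \<in> TT_variety ns r \<longleftrightarrow>
     A \<in> tensors ns \<and> (\<forall>i\<in>{1..<length ns}. TT_rank_at_most ns i (r i) A)"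
  by (simp add: TT_variety_def mat_rank_matricization_le_iff)

section \<open>Orthonormal systems and row spaces\<close>

text \<open>The inner product is the sum over \<open>I\<close>. Vectors of norm 0 are allowed, so
  that \<open>q\<close> keeps the index set of \<open>b\<close> even if \<open>b\<close> is linearly
  dependent. The last two clauses put each \<open>q k\<close> into the span of \<open>b\<close> and
  let the orthogonal projection given by \<open>q\<close> fix each \<open>b j\<close>.\<close>

definition orthonormalizes ::
  "'a set \<Rightarrow> 'k set \<Rightarrow> ('k \<Rightarrow> 'a \<Rightarrow> real) \<Rightarrow> ('k \<Rightarrow> 'a \<Rightarrow> real) \<Rightarrow> ('k \<Rightarrow> 'k \<Rightarrow> real) \<Rightarrow> bool" where
  "orthonormalizes I S b q c \<longleftrightarrow>
     (\<forall>k\<in>S. \<forall>l\<in>S. k \<noteq> l \<longrightarrow> (\<Sum>i\<in>I. q k i * q l i) = 0) \<and>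
     (\<forall>k\<in>S. (\<Sum>i\<in>I. q k i * q k i) \<in> {0, 1}) \<and>
     (\<forall>k\<in>S. \<forall>i\<in>I. q k i = (\<Sum>j\<in>S. c k j * b j i)) \<and>
     (\<forall>j\<in>S. \<forall>i\<in>I. b j i = (\<Sum>k\<in>S. q k i * (\<Sum>i'\<in>I. q k i' * b j i')))"

lemma orthonormalizesD:
  assumes "orthonormalizes I S b q c"
  shows "\<And>k l. k \<in> S \<Longrightarrow> l \<in> S \<Longrightarrow> k \<noteq> l \<Longrightarrow> (\<Sum>i\<in>I. q k i * q l i) = 0"
    and "\<And>k. k \<in> S \<Longrightarrow> (\<Sum>i\<in>I. q k i * q k i) = 0 \<or> (\<Sum>i\<in>I. q k i * q k i) = 1"
    and "\<And>k i. k \<in> S \<Longrightarrow> i \<in> I \<Longrightarrow> q k i = (\<Sum>j\<in>S. c k j * b j i)"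
    and "\<And>j i. j \<in> S \<Longrightarrow> i \<in> I \<Longrightarrow> b j i = (\<Sum>k\<in>S. q k i * (\<Sum>i'\<in>I. q k i' * b j i'))"
  using assms unfolding orthonormalizes_def by (blast, blast, blast, blast)

text \<open>Gram-Schmidt by induction on \<open>S\<close>: the residual of the new vector is
  normalized, or replaced by zero if it vanishes on \<open>I\<close>.\<close>

lemma Gram_Schmidt_finite:
  fixes b :: "'k \<Rightarrow> 'a \<Rightarrow> real"
  assumes "finite I" and "finite S"
  shows "\<exists>q c. orthonormalizes I S b q c"
  using \<open>finite S\<close>
proof (induction S)
  case empty
  show ?case by (simp add: orthonormalizes_def)
next
  case (insert x S)
  define ip :: "('a \<Rightarrow> real) \<Rightarrow> ('a \<Rightarrow> real) \<Rightarrow> real" where "ip f g = (\<Sum>i\<in>I. f i * g i)" for f g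
  obtain q c where IH: "orthonormalizes I S b q c" using insert.IH by blast
  note q = orthonormalizesD(1,2)[OF IH, folded ip_def]
    and c = orthonormalizesD(3)[OF IH]
    and b = orthonormalizesD(4)[OF IH, folded ip_def]
  have ip_commute: "ip f g = ip g f" for f g by (simp add: ip_def mult.commute)
  have ip_lincomb: "ip f g = (\<Sum>k\<in>T. u k * ip f (h k))"
    if "\<And>i. i \<in> I \<Longrightarrow> g i = (\<Sum>k\<in>T. u k * h k i)" for f g u h and T :: "'k set"
  proof -
    have "ip f g = (\<Sum>i\<in>I. \<Sum>k\<in>T. u k * (f i * h k i))"
      unfolding ip_def by (intro sum.cong) (simp_all add: that sum_distrib_left mult_ac)
    also have "\<dots> = (\<Sum>k\<in>T. u k * ip f (h k))"
      unfolding ip_def by (subst sum.swap) (simp add: sum_distrib_left)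
    finally show ?thesis .
  qed
  \<comment> \<open>The residual of \<open>b x\<close> after projection to the span of the vectors
    \<open>q k\<close> found so far.\<close>
  define w where "w i = b x i - (\<Sum>k\<in>S. ip (q k) (b x) * q k i)" for i
  have ip_zero: "f i = 0" if "ip f f = 0" "i \<in> I" for f i
    using that \<open>finite I\<close> unfolding ip_def by (subst (asm) sum_nonneg_eq_0_iff) auto
  have ip_w: "ip f w = ip f (b x) - (\<Sum>k\<in>S. ip (q k) (b x) * ip f (q k))" for f
  proof -
    have "ip f w = ip f (b x) - ip f (\<lambda>i. \<Sum>k\<in>S. ip (q k) (b x) * q k i)"
      by (simp add: ip_def w_def right_diff_distrib sum_subtractf)
    then show ?thesis
      using ip_lincomb[of "\<lambda>i. \<Sum>k\<in>S. ip (q k) (b x) * q k i" "\<lambda>k. ip (q k) (b x)" q S f] by simp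
  qed
  have qw: "ip (q l) w = 0" if l: "l \<in> S" for l
  proof -
    have "(\<Sum>k\<in>S. ip (q k) (b x) * ip (q l) (q k)) = (\<Sum>k\<in>{l}. ip (q k) (b x) * ip (q l) (q k))"
      using l q(1) \<open>finite S\<close> by (intro sum.mono_neutral_right) auto
    then have "ip (q l) w = ip (q l) (b x) * (1 - ip (q l) (q l))"
      by (simp add: ip_w algebra_simps)
    also have "\<dots> = 0"
    \<comment> \<open>A vector \<open>q l\<close> of norm 0 is orthogonal to \<open>b x\<close> too;
      otherwise its norm is 1 and the second factor vanishes.\<close>
    proof (cases "ip (q l) (q l) = 0")
      case True
      then have "ip (q l) (b x) = 0" using ip_zero[OF True] by (simp add: ip_def)
      then show ?thesis by simp
    qed (use q(2)[OF l] in simp)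
    finally show ?thesis .
  qed
  have wb: "ip w (b j) = 0" if "j \<in> S" for j
    using ip_lincomb[of "b j" "\<lambda>k. ip (q k) (b j)" q S w] b[OF that] qw
    by (simp add: mult.commute ip_commute[of w])
  have wx: "ip w (b x) = ip w w"
    using ip_w[of w] qw by (simp add: ip_commute[of w "q _"])
  \<comment> \<open>Since \<open>1 / 0 = 0\<close>, a residual that vanishes on \<open>I\<close>
    yields \<open>s = 0\<close> and hence a zero vector, without a separate construction.\<close>
  define s where "s = 1 / sqrt (ip w w)"
  have nonneg: "ip w w \<ge> 0" by (simp add: ip_def sum_nonneg)
  have ss: "s * s * ip w w = 0 \<or> s * s * ip w w = 1"
    using nonneg by (cases "ip w w = 0") (auto simp: s_def)
  have ssw: "s * s * ip w w * w i = w i" if "i \<in> I" for i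
    using ip_zero[OF _ that, of w] nonneg by (cases "ip w w = 0") (auto simp: s_def)
  define q' where "q' = q(x := (\<lambda>i. s * w i))"
  \<comment> \<open>For the new index, the earlier \<open>q l\<close> in \<open>w\<close> are
    expanded in terms of \<open>b\<close>; the earlier vectors get coefficient 0 at
    \<open>b x\<close>.\<close>
  define c' where "c' k j = (if k = x then s * (if j = x then 1 else - (\<Sum>l\<in>S. ip (q l) (b x) * c l j))
    else if j = x then 0 else c k j)" for k j
  have q'S: "q' k = q k" if "k \<in> S" for k using that insert.hyps by (auto simp: q'_def)
  have q'x: "q' x = (\<lambda>i. s * w i)" by (simp add: q'_def)
  have ip_s: "ip f (\<lambda>i. s * w i) = s * ip f w" "ip (\<lambda>i. s * w i) f = s * ip w f" for f
    by (simp_all add: ip_def sum_distrib_left mult_ac)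
  show ?case unfolding orthonormalizes_def
  proof (intro exI[of _ q'] exI[of _ c'] conjI ballI impI)
    fix k l assume kl: "k \<in> insert x S" "l \<in> insert x S" "k \<noteq> l"
    have "ip (q' k) (q' l) = 0"
      using kl q(1) qw by (auto simp: q'S q'x ip_s ip_commute[of w "q _"])
    then show "(\<Sum>i\<in>I. q' k i * q' l i) = 0" by (simp add: ip_def)
  next
    fix k assume k: "k \<in> insert x S"
    have "ip (q' k) (q' k) \<in> {0, 1}"
    proof (cases "k = x")
      case True
      then show ?thesis using ss by (simp add: q'x ip_s mult.assoc)
    next
      case False
      then show ?thesis using k q(2)[of k] by (simp add: q'S)
    qed
    then show "(\<Sum>i\<in>I. q' k i * q' k i) \<in> {0, 1}" by (simp add: ip_def)
  next
    fix k i assume ki: "k \<in> insert x S" "i \<in> I"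
    show "q' k i = (\<Sum>j\<in>insert x S. c' k j * b j i)"
    proof (cases "k = x")
      case True
      have "(\<Sum>j\<in>S. c' x j * b j i) = (\<Sum>j\<in>S. - (s * (\<Sum>l\<in>S. ip (q l) (b x) * c l j)) * b j i)"
        using insert.hyps by (intro sum.cong) (auto simp: c'_def)
      also have "\<dots> = - s * (\<Sum>j\<in>S. \<Sum>l\<in>S. ip (q l) (b x) * (c l j * b j i))"
        by (simp add: sum_distrib_left sum_distrib_right sum_negf mult_ac)
      also have "\<dots> = - s * (\<Sum>l\<in>S. ip (q l) (b x) * q l i)"
        by (subst sum.swap) (use c ki in \<open>simp add: sum_distrib_left\<close>)
      finally show ?thesis
        using insert.hyps True by (simp add: q'x w_def c'_def algebra_simps)
    next
      case False
      then have "k \<in> S" using ki by simp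
      have "(\<Sum>j\<in>S. c' k j * b j i) = (\<Sum>j\<in>S. c k j * b j i)"
        using insert.hyps False by (intro sum.cong) (auto simp: c'_def)
      then show ?thesis
        using insert.hyps False \<open>k \<in> S\<close> ki c[of k i] by (simp add: q'S c'_def)
    qed
  next
    fix j i assume ji: "j \<in> insert x S" "i \<in> I"
    \<comment> \<open>The new vector contributes nothing to the projection of an earlier
      \<open>b j\<close>, and exactly the residual \<open>w\<close> to that of
      \<open>b x\<close>.\<close>
    have "(\<Sum>k\<in>insert x S. q' k i * ip (q' k) (b j)) =
        s * s * ip w (b j) * w i + (\<Sum>k\<in>S. q k i * ip (q k) (b j))"
      using insert.hyps by (simp add: q'S q'x ip_s mult_ac)
    also have "\<dots> = b j i"
    proof (cases "j = x")
      case True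
      have "s * s * ip w (b j) * w i = w i" unfolding True wx by (rule ssw[OF ji(2)])
      moreover have "b x i = w i + (\<Sum>k\<in>S. q k i * ip (q k) (b x))"
        by (simp add: w_def mult.commute)
      ultimately show ?thesis unfolding True by linarith
    next
      case False
      then show ?thesis using ji wb b by simp
    qed
    finally show "b j i = (\<Sum>k\<in>insert x S. q' k i * (\<Sum>i'\<in>I. q' k i' * b j i'))"
      by (simp add: ip_def)
  qed
qed

text \<open>The columns of \<open>f\<close> are combinations of the \<open>r\<close> left factors,
  so the projection obtained by orthonormalizing these fixes every column. Vectors of norm at most 1
  have entries bounded by 1, which is the compactness used along a sequence of matrices.\<close>

lemma rank_at_most_bounded_projection:
  assumes "rank_at_most r I J f" and "finite I"
  obtains q where "\<And>k i. k < r \<Longrightarrow> i \<in> I \<Longrightarrow> \<bar>q k i\<bar> \<le> 1"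
    "\<And>i j. i \<in> I \<Longrightarrow> j \<in> J \<Longrightarrow> f i j = (\<Sum>k<r. q k i * (\<Sum>i'\<in>I. q k i' * f i' j))"
proof -
  obtain b c where f: "\<And>i j. i \<in> I \<Longrightarrow> j \<in> J \<Longrightarrow> f i j = (\<Sum>k<r. b k i * c k j)"
    using assms(1) unfolding rank_at_most_def by blast
  obtain q c' where q: "orthonormalizes I {..<r} b q c'"
    using Gram_Schmidt_finite[OF \<open>finite I\<close>, of "{..<r}" b] by blast
  show ?thesis
  proof
    fix k i assume "k < r" "i \<in> I"
    then have "q k i * q k i \<le> (\<Sum>i\<in>I. q k i * q k i)"
      using \<open>finite I\<close> by (intro member_le_sum) auto
    also have "\<dots> \<le> 1" using orthonormalizesD(2)[OF q, of k] \<open>k < r\<close> by auto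
    finally show "\<bar>q k i\<bar> \<le> 1" by (simp add: abs_square_le_1 power2_eq_square[symmetric])
  next
    fix i j assume ij: "i \<in> I" "j \<in> J"
    have "(\<Sum>k<r. q k i * (\<Sum>i'\<in>I. q k i' * f i' j)) =
        (\<Sum>k<r. q k i * (\<Sum>i'\<in>I. \<Sum>l<r. c l j * (q k i' * b l i')))"
      using ij by (simp add: f sum_distrib_left mult_ac)
    also have "\<dots> = (\<Sum>k<r. q k i * (\<Sum>l<r. c l j * (\<Sum>i'\<in>I. q k i' * b l i')))"
      by (subst sum.swap) (simp add: sum_distrib_left)
    also have "\<dots> = (\<Sum>k<r. \<Sum>l<r. c l j * (q k i * (\<Sum>i'\<in>I. q k i' * b l i')))"
      by (simp add: sum_distrib_left mult_ac)
    also have "\<dots> = (\<Sum>l<r. c l j * (\<Sum>k<r. q k i * (\<Sum>i'\<in>I. q k i' * b l i')))"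
      by (subst sum.swap) (simp add: sum_distrib_left)
    also have "\<dots> = (\<Sum>l<r. c l j * b l i)"
      using ij by (intro sum.cong refl) (simp add: orthonormalizesD(4)[OF q, symmetric])
    also have "\<dots> = f i j" using f ij by (simp add: mult.commute)
    finally show "f i j = (\<Sum>k<r. q k i * (\<Sum>i'\<in>I. q k i' * f i' j))" by simp
  qed
qed

text \<open>The coefficients \<open>y n\<close> may diverge, so the limit is not taken there.
  Instead, the projection to the span of the rows of \<open>f\<close> fixes every
  \<open>g n\<close>, hence by continuity also \<open>h\<close>; expanding the orthonormalized rows
  in the rows of \<open>f\<close> then gives \<open>z\<close>.\<close>

lemma row_space_closed:
  fixes f :: "'a \<Rightarrow> 'b \<Rightarrow> real"
  assumes "finite I" and "finite J"
    and g: "\<And>n j. j \<in> J \<Longrightarrow> g n j = (\<Sum>i\<in>I. y n i * f i j)"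
    and lim: "\<And>j. j \<in> J \<Longrightarrow> (\<lambda>n. g n j) \<longlonglongrightarrow> h j"
  obtains z where "\<And>j. j \<in> J \<Longrightarrow> h j = (\<Sum>i\<in>I. z i * f i j)"
proof -
  obtain q c where qc: "orthonormalizes J I f q c"
    using Gram_Schmidt_finite[OF \<open>finite J\<close> \<open>finite I\<close>, of f] by blast
  note c = orthonormalizesD(3)[OF qc] and f = orthonormalizesD(4)[OF qc]
  have gproj: "g n j = (\<Sum>k\<in>I. q k j * (\<Sum>j'\<in>J. q k j' * g n j'))" if j: "j \<in> J" for n j
  proof -
    have "g n j = (\<Sum>i\<in>I. \<Sum>k\<in>I. q k j * (y n i * (\<Sum>j'\<in>J. q k j' * f i j')))"
      unfolding g[OF j] by (intro sum.cong refl) (subst f[OF _ j], auto simp: sum_distrib_left mult_ac)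
    also have "\<dots> = (\<Sum>k\<in>I. q k j * (\<Sum>i\<in>I. y n i * (\<Sum>j'\<in>J. q k j' * f i j')))"
      by (subst sum.swap) (simp add: sum_distrib_left)
    also have "\<dots> = (\<Sum>k\<in>I. q k j * (\<Sum>j'\<in>J. q k j' * g n j'))"
      by (intro sum.cong refl arg_cong2[where f = "(*)"], simp add: g sum_distrib_left, subst sum.swap)
        (simp add: mult_ac)
    finally show ?thesis .
  qed
  have gq: "(\<lambda>n. \<Sum>k\<in>I. q k j * (\<Sum>j'\<in>J. q k j' * g n j')) \<longlonglongrightarrow> h j" if "j \<in> J" for j
    unfolding gproj[OF that, symmetric] by (rule lim[OF that])
  have h: "h j = (\<Sum>k\<in>I. q k j * (\<Sum>j'\<in>J. q k j' * h j'))" if "j \<in> J" for j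
    by (rule LIMSEQ_unique[OF gq[OF that]]) (auto intro!: tendsto_intros lim)
  show ?thesis
  proof
    fix j assume j: "j \<in> J"
    have "h j = (\<Sum>k\<in>I. \<Sum>i\<in>I. c k i * (\<Sum>j'\<in>J. q k j' * h j') * f i j)"
      unfolding h[OF j]
      by (intro sum.cong refl) (simp add: c[OF _ j] sum_distrib_right sum_distrib_left mult_ac)
    also have "\<dots> = (\<Sum>i\<in>I. (\<Sum>k\<in>I. c k i * (\<Sum>j'\<in>J. q k j' * h j')) * f i j)"
      by (subst sum.swap) (simp add: sum_distrib_right)
    finally show "h j = (\<Sum>i\<in>I. (\<Sum>k\<in>I. c k i * (\<Sum>j'\<in>J. q k j' * h j')) * f i j)" .
  qed
qed

section \<open>First-order factorization along a sequence of bounded rank\<close>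

text \<open>Bolzano-Weierstrass for one coordinate after the other; passing to a further subsequence
  keeps the earlier coordinates convergent.\<close>

lemma finite_simultaneous_subsequence:
  fixes f :: "nat \<Rightarrow> 'a \<Rightarrow> real"
  assumes "finite T" and "\<And>n x. x \<in> T \<Longrightarrow> \<bar>f n x\<bar> \<le> B"
  obtains s where "strict_mono (s :: nat \<Rightarrow> nat)" "\<And>x. x \<in> T \<Longrightarrow> convergent (\<lambda>n. f (s n) x)"
proof -
  have "\<exists>s. strict_mono (s :: nat \<Rightarrow> nat) \<and> (\<forall>x\<in>T. convergent (\<lambda>n. f (s n) x))"
    using assms
  proof (induction T)
    case empty
    then show ?case using strict_mono_id by blast
  next
    case (insert x T)
    then obtain s where s: "strict_mono (s :: nat \<Rightarrow> nat)" "\<forall>x\<in>T. convergent (\<lambda>n. f (s n) x)"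
      by auto
    have "seq_compact {-B..B}"
      by (rule compact_imp_seq_compact[OF compact_Icc])
    moreover have "f (s n) x \<in> {-B..B}" for n
      using insert.prems[of x "s n"] by (auto simp: abs_le_iff)
    ultimately obtain l s' where s': "strict_mono s'" "(\<lambda>n. f (s (s' n)) x) \<longlonglongrightarrow> l"
      using seq_compactE[of "{-B..B}" "\<lambda>n. f (s n) x"] unfolding comp_def by blast
    have "convergent (\<lambda>n. f (s (s' n)) y)" if "y \<in> T" for y
      using s(2) that convergent_subseq_convergent[OF _ s'(1), of "\<lambda>n. f (s n) y"]
      by (auto simp: comp_def)
    then show ?case using s(1) s' strict_mono_o[OF s(1) s'(1)]
      by (intro exI[of _ "s \<circ> s'"]) (auto simp: convergent_def comp_def)
  qed
  then show ?thesis using that by blast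
qed

text \<open>
  In matrix notation with \<open>\<Pi> = Q Q\<^sup>T\<close> and \<open>W = K Q\<close> the conclusion reads \<open>\<Pi> A = A\<close> and
  \<open>K \<Pi> A + \<Pi> v = v\<close>. Here \<open>Q\<close> is a limit of orthonormal bases \<open>Q\<^sub>n\<close> of the column spaces of
  \<open>X\<^sub>n\<close>, and \<open>K A\<close> is the limit of \<open>a\<^sub>n (Q\<^sub>n Q\<^sub>n\<^sup>T - 1) A\<close>.
\<close>

lemma tangent_factorization:
  fixes X :: "nat \<Rightarrow> 'a \<Rightarrow> 'b \<Rightarrow> real"
  assumes "finite I" and "finite J"
    and rank: "\<And>n. rank_at_most r I J (X n)"
    and X: "\<And>i j. i \<in> I \<Longrightarrow> j \<in> J \<Longrightarrow> (\<lambda>n. X n i j) \<longlonglongrightarrow> A i j"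
    and v: "\<And>i j. i \<in> I \<Longrightarrow> j \<in> J \<Longrightarrow> (\<lambda>n. a n * (X n i j - A i j)) \<longlonglongrightarrow> v i j"
  obtains q w where
    "\<And>i j. i \<in> I \<Longrightarrow> j \<in> J \<Longrightarrow> (\<Sum>k<r. q k i * (\<Sum>i'\<in>I. q k i' * A i' j)) = A i j"
    "\<And>i j. i \<in> I \<Longrightarrow> j \<in> J \<Longrightarrow> (\<Sum>k<r. w k i * (\<Sum>i'\<in>I. q k i' * A i' j)) +
       (\<Sum>k<r. q k i * (\<Sum>i'\<in>I. q k i' * v i' j)) = v i j"
proof -
  have "\<exists>q. \<forall>n. (\<forall>k<r. \<forall>i\<in>I. \<bar>q n k i\<bar> \<le> 1) \<and>
      (\<forall>i\<in>I. \<forall>j\<in>J. X n i j = (\<Sum>k<r. q n k i * (\<Sum>i'\<in>I. q n k i' * X n i' j)))"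
  proof (intro choice allI)
    show "\<exists>q. (\<forall>k<r. \<forall>i\<in>I. \<bar>q k i\<bar> \<le> 1) \<and>
      (\<forall>i\<in>I. \<forall>j\<in>J. X n i j = (\<Sum>k<r. q k i * (\<Sum>i'\<in>I. q k i' * X n i' j)))" for n
      by (rule rank_at_most_bounded_projection[OF rank[of n] \<open>finite I\<close>]) blast
  qed
  then obtain q where q1: "\<And>n k i. k < r \<Longrightarrow> i \<in> I \<Longrightarrow> \<bar>q n k i\<bar> \<le> 1"
    and qX: "\<And>n i j. i \<in> I \<Longrightarrow> j \<in> J \<Longrightarrow>
      X n i j = (\<Sum>k<r. q n k i * (\<Sum>i'\<in>I. q n k i' * X n i' j))"
    by blast
  have fin: "finite ({..<r} \<times> I)" using \<open>finite I\<close> by simp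
  have "\<bar>q n (fst x) (snd x)\<bar> \<le> 1" if "x \<in> {..<r} \<times> I" for n x
    using q1 that by auto
  from finite_simultaneous_subsequence[of _ "\<lambda>n x. q n (fst x) (snd x)", OF fin this] obtain s where s: "strict_mono (s :: nat \<Rightarrow> nat)"
    and conv: "\<And>x. x \<in> {..<r} \<times> I \<Longrightarrow> convergent (\<lambda>n. q (s n) (fst x) (snd x))"
    by blast
  define Q where "Q k i = lim (\<lambda>n. q (s n) k i)" for k i
  have Q: "(\<lambda>n. q (s n) k i) \<longlonglongrightarrow> Q k i" if "k < r" "i \<in> I" for k i
    using conv[of "(k, i)"] that by (simp add: Q_def convergent_LIMSEQ_iff)
  have Xs: "(\<lambda>n. X (s n) i j) \<longlonglongrightarrow> A i j" if "i \<in> I" "j \<in> J" for i j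
    using LIMSEQ_subseq_LIMSEQ[OF X[OF that] s] by (simp add: comp_def)
  have vs: "(\<lambda>n. a (s n) * (X (s n) i j - A i j)) \<longlonglongrightarrow> v i j" if "i \<in> I" "j \<in> J" for i j
    using LIMSEQ_subseq_LIMSEQ[OF v[OF that] s] by (simp add: comp_def)
  have QA: "(\<Sum>k<r. Q k i * (\<Sum>i'\<in>I. Q k i' * A i' j)) = A i j" if ij: "i \<in> I" "j \<in> J" for i j
  proof (rule LIMSEQ_unique)
    show "(\<lambda>n. \<Sum>k<r. q (s n) k i * (\<Sum>i'\<in>I. q (s n) k i' * X (s n) i' j)) \<longlonglongrightarrow>
        (\<Sum>k<r. Q k i * (\<Sum>i'\<in>I. Q k i' * A i' j))"
      using ij by (auto intro!: tendsto_intros Q Xs)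
    show "(\<lambda>n. \<Sum>k<r. q (s n) k i * (\<Sum>i'\<in>I. q (s n) k i' * X (s n) i' j)) \<longlonglongrightarrow> A i j"
      unfolding qX[OF ij, symmetric] by (rule Xs[OF ij])
  qed
  define D where
    "D n i j = a (s n) * ((\<Sum>k<r. q (s n) k i * (\<Sum>i'\<in>I. q (s n) k i' * A i' j)) - A i j)" for n i j
  have D_lim: "(\<lambda>n. D n i j) \<longlonglongrightarrow> v i j - (\<Sum>k<r. Q k i * (\<Sum>i'\<in>I. Q k i' * v i' j))"
    if ij: "i \<in> I" "j \<in> J" for i j
  proof -
    \<comment> \<open>With \<Pi> the projection for \<open>X (s n)\<close>, the identity \<Pi> X = X
      turns a (\<Pi> A - A) into a (X - A) - \<Pi> (a (X - A)). Both terms converge although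
      \<open>a\<close> may be unbounded.\<close>
    have "D n i j = a (s n) * (X (s n) i j - A i j) -
        (\<Sum>k<r. q (s n) k i * (\<Sum>i'\<in>I. q (s n) k i' * (a (s n) * (X (s n) i' j - A i' j))))" for n
    proof -
      have "(\<Sum>k<r. q (s n) k i * (\<Sum>i'\<in>I. q (s n) k i' * (a (s n) * (X (s n) i' j - A i' j)))) =
          a (s n) * ((\<Sum>k<r. q (s n) k i * (\<Sum>i'\<in>I. q (s n) k i' * X (s n) i' j)) -
            (\<Sum>k<r. q (s n) k i * (\<Sum>i'\<in>I. q (s n) k i' * A i' j)))"
        by (simp add: sum_distrib_left sum_subtractf right_diff_distrib mult_ac)
      then show ?thesis unfolding D_def qX[OF ij, symmetric] by (simp add: right_diff_distrib)
    qed
    then show ?thesis using ij by (auto intro!: tendsto_intros Q vs)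
  qed
  \<comment> \<open>Each row of \<open>D n\<close> lies in the row space of \<open>A\<close>, with
    coefficients from a (\<Pi> - 1), where \<open>of_bool (m = i)\<close> is the identity matrix.
    These need not converge, which is why closedness of the row space is needed to obtain
    \<open>K\<close>.\<close>
  have D_row: "D n i j = (\<Sum>m\<in>I. a (s n) * ((\<Sum>k<r. q (s n) k i * q (s n) k m) - of_bool (m = i)) * A m j)"
    if ij: "i \<in> I" "j \<in> J" for n i j
  proof -
    have "(\<Sum>k<r. q (s n) k i * (\<Sum>m\<in>I. q (s n) k m * A m j)) =
        (\<Sum>m\<in>I. (\<Sum>k<r. q (s n) k i * q (s n) k m) * A m j)"
      by (simp add: sum_distrib_left sum_distrib_right mult.assoc) (rule sum.swap)
    moreover have "(\<Sum>m\<in>I. of_bool (m = i) * A m j) = A i j"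
      using ij \<open>finite I\<close> by simp
    ultimately show ?thesis
      unfolding D_def by (simp add: left_diff_distrib sum_subtractf mult.assoc flip: sum_distrib_left)
  qed
  have "\<forall>i\<in>I. \<exists>z. \<forall>j\<in>J.
      v i j - (\<Sum>k<r. Q k i * (\<Sum>i'\<in>I. Q k i' * v i' j)) = (\<Sum>m\<in>I. z m * A m j)"
  proof
    fix i assume i: "i \<in> I"
    show "\<exists>z. \<forall>j\<in>J. v i j - (\<Sum>k<r. Q k i * (\<Sum>i'\<in>I. Q k i' * v i' j)) = (\<Sum>m\<in>I. z m * A m j)"
      by (rule row_space_closed[OF \<open>finite I\<close> \<open>finite J\<close> D_row[OF i] D_lim[OF i]]) auto
  qed
  from bchoice[OF this] obtain K where K: "\<And>i j. i \<in> I \<Longrightarrow> j \<in> J \<Longrightarrow>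
      v i j - (\<Sum>k<r. Q k i * (\<Sum>i'\<in>I. Q k i' * v i' j)) = (\<Sum>m\<in>I. K i m * A m j)"
    by blast
  have swap: "(\<Sum>k<r. (\<Sum>m\<in>I. K i m * Q k m) * T k) = (\<Sum>m\<in>I. K i m * (\<Sum>k<r. Q k m * T k))"
    for i and T :: "nat \<Rightarrow> real"
    by (simp add: sum_distrib_left sum_distrib_right mult.assoc) (rule sum.swap)
  show ?thesis
  \<comment> \<open>With the second factor \<open>K Q\<close>, the first sum of the conclusion
    becomes K \<Pi> A, which is \<open>K A\<close> because \<Pi> fixes \<open>A\<close>.\<close>
  proof (rule that[of Q "\<lambda>k i. \<Sum>m\<in>I. K i m * Q k m"])
    fix i j assume ij: "i \<in> I" "j \<in> J"
    show "(\<Sum>k<r. Q k i * (\<Sum>i'\<in>I. Q k i' * A i' j)) = A i j" by (rule QA[OF ij])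
    have "(\<Sum>k<r. (\<Sum>m\<in>I. K i m * Q k m) * (\<Sum>i'\<in>I. Q k i' * A i' j)) =
        (\<Sum>m\<in>I. K i m * (\<Sum>k<r. Q k m * (\<Sum>i'\<in>I. Q k i' * A i' j)))"
      by (rule swap)
    also have "\<dots> = (\<Sum>m\<in>I. K i m * A m j)" using ij QA by simp
    finally show "(\<Sum>k<r. (\<Sum>m\<in>I. K i m * Q k m) * (\<Sum>i'\<in>I. Q k i' * A i' j)) +
        (\<Sum>k<r. Q k i * (\<Sum>i'\<in>I. Q k i' * v i' j)) = v i j"
      using K[OF ij] by simp
  qed
qed

section \<open>The polynomial arc\<close>

text \<open>The matrix \<open>S\<close> tensored with the identity on the modes after the
  \<open>j\<close>-th. The explicit zero keeps the result among the tensors.\<close>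

definition mode_op :: "nat list \<Rightarrow> nat \<Rightarrow> (nat list \<Rightarrow> nat list \<Rightarrow> real) \<Rightarrow> tensor \<Rightarrow> tensor" where
  "mode_op ns j S Y = (\<lambda>is. if is \<in> multi_indices ns
     then \<Sum>p\<in>multi_indices (take j ns). S (take j is) p * Y (p @ drop j is) else 0)"

lemma mode_op_in_tensors: "mode_op ns j S Y \<in> tensors ns"
  by (simp add: mode_op_def tensors_def)

text \<open>The \<open>j\<close>-th matricization is multiplied from the left by a kernel that is
  itself a product of length \<open>r\<close>; the product of the right half with \<open>Y\<close>
  supplies the right factors.\<close>

lemma mode_op_rank_same:
  assumes "j \<le> length ns"
  shows "TT_rank_at_most ns j r (mode_op ns j (\<lambda>p p'. \<Sum>k<r. u k p * q k p') Y)"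
proof -
  have "mode_op ns j (\<lambda>p p'. \<Sum>k<r. u k p * q k p') Y (p @ s) =
      (\<Sum>k<r. u k p * (\<Sum>p'\<in>multi_indices (take j ns). q k p' * Y (p' @ s)))"
    if p: "p \<in> multi_indices (take j ns)" and s: "s \<in> multi_indices (drop j ns)" for p s
  proof -
    have "length p = j" using length_multi_indices[OF p] assms by simp
    then show ?thesis using append_in_multi_indices[OF p s]
      by (simp add: mode_op_def sum_distrib_left sum_distrib_right mult.assoc) (rule sum.swap)
  qed
  then show ?thesis unfolding rank_at_most_def
    by (intro exI[of _ u] exI[of _ "\<lambda>k s. \<Sum>p'\<in>multi_indices (take j ns). q k p' * Y (p' @ s)"]) blast
qed

text \<open>For \<open>j \<le> i\<close> the operator acts on the row index of the
  \<open>i\<close>-th matricization alone, so it changes the left factors of a factorization and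
  keeps the right ones.\<close>

lemma mode_op_rank_mono:
  assumes "j \<le> i" and "i \<le> length ns" and "TT_rank_at_most ns i r Y"
  shows "TT_rank_at_most ns i r (mode_op ns j S Y)"
proof -
  obtain b c where bc: "\<And>p s. p \<in> multi_indices (take i ns) \<Longrightarrow> s \<in> multi_indices (drop i ns) \<Longrightarrow>
      Y (p @ s) = (\<Sum>k<r. b k p * c k s)"
    using assms(3) unfolding rank_at_most_def by blast
  let ?b = "\<lambda>k p. \<Sum>p'\<in>multi_indices (take j ns). S (take j p) p' * b k (p' @ drop j p)"
  have "mode_op ns j S Y (p @ s) = (\<Sum>k<r. ?b k p * c k s)"
    if p: "p \<in> multi_indices (take i ns)" and s: "s \<in> multi_indices (drop i ns)" for p s
  proof -
    have len: "length p = i" using length_multi_indices[OF p] assms by simp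
    have jj: "take j (take i ns) = take j ns" using \<open>j \<le> i\<close> by (simp add: min_absorb1)
    have "mode_op ns j S Y (p @ s) =
        (\<Sum>p'\<in>multi_indices (take j ns). S (take j p) p' * Y ((p' @ drop j p) @ s))"
      using append_in_multi_indices[OF p s] len \<open>j \<le> i\<close> by (simp add: mode_op_def)
    also have "\<dots> = (\<Sum>p'\<in>multi_indices (take j ns). S (take j p) p' * (\<Sum>k<r. b k (p' @ drop j p) * c k s))"
    proof (intro sum.cong refl)
      fix p' assume "p' \<in> multi_indices (take j ns)"
      moreover have "drop j p \<in> multi_indices (drop j (take i ns))"
        using p multi_indices_split by blast
      ultimately have "p' @ drop j p \<in> multi_indices (take i ns)"
        using append_in_multi_indices[of p' j "take i ns"] jj by simp
      then show "S (take j p) p' * Y ((p' @ drop j p) @ s) =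
          S (take j p) p' * (\<Sum>k<r. b k (p' @ drop j p) * c k s)"
        by (simp only: bc[OF _ s])
    qed
    also have "\<dots> = (\<Sum>k<r. ?b k p * c k s)"
      by (simp add: sum_distrib_left sum_distrib_right mult.assoc) (rule sum.swap)
    finally show ?thesis .
  qed
  then show ?thesis unfolding rank_at_most_def by (intro exI[of _ ?b] exI[of _ c]) blast
qed

text \<open>Each entry has its own polynomial remainder. Demanding a polynomial rather than a bound
  of order \<open>t\<^sup>2\<close> makes the arc analytic as well as fixing its initial
  velocity.\<close>

definition first_order_at :: "tensor \<Rightarrow> tensor \<Rightarrow> (real \<Rightarrow> tensor) \<Rightarrow> bool" where
  "first_order_at A v Y \<longleftrightarrow> (\<forall>is. \<exists>P. \<forall>t. Y t is = A is + t * v is + t\<^sup>2 * poly P t)"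

text \<open>In matrix form the kernel is (Q + t W) Q^T. The two assumed identities say that the
  constant coefficient of the product stays \<open>A\<close> and the linear one, W Q^T A + Q Q^T v,
  stays \<open>v\<close>.\<close>

lemma mode_op_first_order:
  fixes q w :: "nat \<Rightarrow> nat list \<Rightarrow> real"
  assumes "A \<in> tensors ns" and "v \<in> tensors ns" and Y: "first_order_at A v Y"
    and A: "\<And>p s. p \<in> multi_indices (take j ns) \<Longrightarrow> s \<in> multi_indices (drop j ns) \<Longrightarrow>
      (\<Sum>k<r. q k p * (\<Sum>p'\<in>multi_indices (take j ns). q k p' * A (p' @ s))) = A (p @ s)"
    and v: "\<And>p s. p \<in> multi_indices (take j ns) \<Longrightarrow> s \<in> multi_indices (drop j ns) \<Longrightarrow>
      (\<Sum>k<r. w k p * (\<Sum>p'\<in>multi_indices (take j ns). q k p' * A (p' @ s))) +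
      (\<Sum>k<r. q k p * (\<Sum>p'\<in>multi_indices (take j ns). q k p' * v (p' @ s))) = v (p @ s)"
  shows "first_order_at A v
    (\<lambda>t. mode_op ns j (\<lambda>p p'. \<Sum>k<r. (q k p + t * w k p) * q k p') (Y t))"
  unfolding first_order_at_def
proof
  fix "is" :: "nat list"
  show "\<exists>P. \<forall>t. mode_op ns j (\<lambda>p p'. \<Sum>k<r. (q k p + t * w k p) * q k p') (Y t) is =
      A is + t * v is + t\<^sup>2 * poly P t"
  proof (cases "is \<in> multi_indices ns")
    case False
    then show ?thesis using assms(1,2)
      by (intro exI[of _ 0]) (simp add: mode_op_def tensors_def)
  next
    case True
    define p s where "p = take j is" and "s = drop j is"
    have ps: "p \<in> multi_indices (take j ns)" "s \<in> multi_indices (drop j ns)" "is = p @ s"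
      using True multi_indices_split[of "is" ns j] by (simp_all add: p_def s_def)
    let ?M = "multi_indices (take j ns)"
    obtain P where P: "\<And>is t. Y t is = A is + t * v is + t\<^sup>2 * poly (P is) t"
      using Y unfolding first_order_at_def by metis
    define \<alpha> \<beta> \<pi> where "\<alpha> k = (\<Sum>p'\<in>?M. q k p' * A (p' @ s))"
      and "\<beta> k = (\<Sum>p'\<in>?M. q k p' * v (p' @ s))"
      and "\<pi> k = (\<Sum>p'\<in>?M. [:q k p':] * P (p' @ s))" for k
    \<comment> \<open>The coefficients from \<open>t\<^sup>2\<close> on in the product of
      \<open>q k p + t * w k p\<close> with
      \<open>\<alpha> k + t * \<beta> k + t\<^sup>2 * poly (\<pi> k) t\<close>, summed over
      \<open>k\<close>.\<close>
    define R where "R = (\<Sum>k<r. [:w k p * \<beta> k:] + [:q k p, w k p:] * \<pi> k)"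
    have "mode_op ns j (\<lambda>p p'. \<Sum>k<r. (q k p + t * w k p) * q k p') (Y t) is =
        A is + t * v is + t\<^sup>2 * poly R t" for t
    proof -
      have "mode_op ns j (\<lambda>p p'. \<Sum>k<r. (q k p + t * w k p) * q k p') (Y t) is =
          (\<Sum>p'\<in>?M. (\<Sum>k<r. (q k p + t * w k p) * q k p') * Y t (p' @ s))"
        using True by (simp add: mode_op_def p_def s_def)
      also have "\<dots> = (\<Sum>k<r. (q k p + t * w k p) * (\<Sum>p'\<in>?M. q k p' * Y t (p' @ s)))"
        by (simp add: sum_distrib_left sum_distrib_right mult.assoc) (rule sum.swap)
      also have "\<dots> = (\<Sum>k<r. (q k p + t * w k p) * (\<alpha> k + t * \<beta> k + t\<^sup>2 * poly (\<pi> k) t))"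
        by (simp add: P \<alpha>_def \<beta>_def \<pi>_def poly_sum sum_distrib_left distrib_left sum.distrib mult_ac)
      also have "\<dots> = (\<Sum>k<r. q k p * \<alpha> k + t * (w k p * \<alpha> k + q k p * \<beta> k) +
          t\<^sup>2 * (w k p * \<beta> k + (q k p + t * w k p) * poly (\<pi> k) t))"
        by (intro sum.cong refl) (simp add: algebra_simps power2_eq_square)
      also have "\<dots> = (\<Sum>k<r. q k p * \<alpha> k) +
          t * ((\<Sum>k<r. w k p * \<alpha> k) + (\<Sum>k<r. q k p * \<beta> k)) + t\<^sup>2 * poly R t"
        by (simp add: R_def poly_sum sum.distrib sum_distrib_left distrib_left mult_ac)
      also have "\<dots> = A is + t * v is + t\<^sup>2 * poly R t"
        using A[OF ps(1,2)] v[OF ps(1,2)] unfolding \<alpha>_def \<beta>_def ps(3) by simp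
      finally show ?thesis .
    qed
    then show ?thesis by blast
  qed
qed

lemma tendsto_fun_iff:
  fixes f :: "'c \<Rightarrow> 'a \<Rightarrow> 'b::topological_space"
  shows "(f \<longlongrightarrow> l) F \<longleftrightarrow> (\<forall>i. ((\<lambda>c. f c i) \<longlongrightarrow> l i) F)"
  using limitin_componentwise[of "\<lambda>i. euclidean" UNIV f l F]
  by (simp add: euclidean_product_topology)

text \<open>Downward induction on \<open>m\<close>, where the arc satisfies the rank bounds for
  \<open>i \<ge> m\<close>. Applying an operator of rank at most \<open>r j\<close> to the first
  \<open>j\<close> modes adds the bound at \<open>j\<close> and preserves those at all
  \<open>i > j\<close>; the opposite order would not allow this argument.\<close>

lemma polynomial_arc:
  assumes "ns \<noteq> []" and A: "A \<in> tensors ns" and tangent: "\<xi> \<in> tangent_cone ns (TT_variety ns r) A"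
  obtains \<gamma> where "\<And>t. \<gamma> t \<in> TT_variety ns r" "first_order_at A \<xi> \<gamma>"
proof -
  obtain x a where x: "\<And>k. x k \<in> TT_variety ns r" "x \<longlonglongrightarrow> A"
    and a: "(\<lambda>k is. a k * (x k is - A is)) \<longlonglongrightarrow> \<xi>"
    using tangent unfolding tangent_cone_def by blast
  have \<xi>: "\<xi> \<in> tensors ns" using tangent by (simp add: tangent_cone_def)
  have "\<exists>\<gamma>. (\<forall>t. \<gamma> t \<in> tensors ns \<and> (\<forall>i\<in>{m..<length ns}. TT_rank_at_most ns i (r i) (\<gamma> t))) \<and>
      first_order_at A \<xi> \<gamma>" if "1 \<le> m" "m \<le> length ns" for m
    using that(2,1)
  proof (induction rule: inc_induct)
    \<comment> \<open>With \<open>m = length ns\<close> there is no rank bound yet, so the straight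
      line through \<open>A\<close> in direction \<open>\<xi>\<close> serves.\<close>
    case base
    show ?case using A \<xi>
      by (intro exI[of _ "\<lambda>t is. A is + t * \<xi> is"])
        (auto simp: first_order_at_def tensors_def intro!: exI[of _ 0])
  next
    case (step j)
    have "1 \<le> Suc j" by simp
    from step.IH[OF this] obtain \<gamma> where \<gamma>: "\<And>t i. i \<in> {Suc j..<length ns} \<Longrightarrow> TT_rank_at_most ns i (r i) (\<gamma> t)"
      "first_order_at A \<xi> \<gamma>"
      by blast
    have "TT_rank_at_most ns j (r j) (x n)" for n
      using x(1)[of n] step by (simp add: TT_variety_iff)
    moreover have "(\<lambda>n. x n (p @ s)) \<longlonglongrightarrow> A (p @ s)"
      and "(\<lambda>n. a n * (x n (p @ s) - A (p @ s))) \<longlonglongrightarrow> \<xi> (p @ s)" for p s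
      using x(2) a by (simp_all add: tendsto_fun_iff)
    ultimately obtain q w where qw:
      "\<And>p s. p \<in> multi_indices (take j ns) \<Longrightarrow> s \<in> multi_indices (drop j ns) \<Longrightarrow>
        (\<Sum>k<r j. q k p * (\<Sum>p'\<in>multi_indices (take j ns). q k p' * A (p' @ s))) = A (p @ s)"
      "\<And>p s. p \<in> multi_indices (take j ns) \<Longrightarrow> s \<in> multi_indices (drop j ns) \<Longrightarrow>
        (\<Sum>k<r j. w k p * (\<Sum>p'\<in>multi_indices (take j ns). q k p' * A (p' @ s))) +
        (\<Sum>k<r j. q k p * (\<Sum>p'\<in>multi_indices (take j ns). q k p' * \<xi> (p' @ s))) = \<xi> (p @ s)"
      by (rule tangent_factorization[of "multi_indices (take j ns)" "multi_indices (drop j ns)" "r j"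
            "\<lambda>n p s. x n (p @ s)" "\<lambda>p s. A (p @ s)" a "\<lambda>p s. \<xi> (p @ s)",
            OF finite_multi_indices finite_multi_indices]) blast+
    define \<gamma>' where "\<gamma>' t = mode_op ns j (\<lambda>p p'. \<Sum>k<r j. (q k p + t * w k p) * q k p') (\<gamma> t)" for t
    have "first_order_at A \<xi> \<gamma>'"
      unfolding \<gamma>'_def by (rule mode_op_first_order[OF A \<xi> \<gamma>(2)]) (simp_all add: qw)
    moreover have "\<gamma>' t \<in> tensors ns" for t unfolding \<gamma>'_def by (rule mode_op_in_tensors)
    moreover have "TT_rank_at_most ns i (r i) (\<gamma>' t)" if "i \<in> {j..<length ns}" for i t
    proof (cases "i = j")
      case True
      then show ?thesis using that mode_op_rank_same[of j ns "r j"] by (simp add: \<gamma>'_def)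
    next
      case False
      then show ?thesis unfolding \<gamma>'_def using that \<gamma>(1)[of i t] by (intro mode_op_rank_mono) auto
    qed
    ultimately show ?case by blast
  qed
  from this[of 1] \<open>ns \<noteq> []\<close> show ?thesis using that by (auto simp: TT_variety_iff Suc_le_eq)
qed

section \<open>Analyticity of polynomial arcs, and initial velocities as tangent vectors\<close>

lemma real_analytic_on_poly: "real_analytic_on (poly P) S"
  unfolding real_analytic_on_def
proof
  fix t\<^sub>0 assume "t\<^sub>0 \<in> S"
  \<comment> \<open>The Taylor expansion of \<open>P\<close> at \<open>t\<^sub>0\<close>. Its
    coefficients vanish beyond the degree, so the series is a finite sum valid for every
    \<open>t\<close>, and any radius will do.\<close>
  define Q where "Q = pcompose P [:t\<^sub>0, 1:]"
  have "(\<lambda>k. coeff Q k * (t - t\<^sub>0) ^ k) sums poly P t" for t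
  proof -
    have "poly P t = poly Q (t - t\<^sub>0)" by (simp add: Q_def poly_pcompose)
    also have "\<dots> = (\<Sum>k\<le>degree Q. coeff Q k * (t - t\<^sub>0) ^ k)" by (rule poly_altdef)
    finally show ?thesis
      using sums_finite[of "{..degree Q}" "\<lambda>k. coeff Q k * (t - t\<^sub>0) ^ k"]
      by (simp add: coeff_eq_0)
  qed
  then show "\<exists>\<rho>>0. \<exists>c. \<forall>t\<in>S. \<bar>t - t\<^sub>0\<bar> < \<rho> \<longrightarrow> (\<lambda>k. c k * (t - t\<^sub>0) ^ k) sums poly P t"
    by (intro exI[of _ "1::real"] conjI exI[of _ "coeff Q"] ballI impI) simp_all
qed

lemma first_order_at_polyE:
  assumes "first_order_at A v \<gamma>"
  obtains P where "(\<lambda>t. \<gamma> t is) = poly P" "poly P 0 = A is" "poly (pderiv P) 0 = v is"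
proof -
  obtain P where P: "\<And>t. \<gamma> t is = A is + t * v is + t\<^sup>2 * poly P t"
    using assms unfolding first_order_at_def by blast
  show ?thesis
    \<comment> \<open>The polynomial \<open>[:0, 0, 1:]\<close> is the square of the
      variable.\<close>
    by (rule that[of "[:A is, v is:] + [:0, 0, 1:] * P"])
      (auto simp: P power2_eq_square algebra_simps pderiv_add pderiv_mult pderiv_pCons)
qed

text \<open>Sample the arc at times \<open>h k\<close> tending to 0 and take \<open>1 / h k\<close>
  as scaling factors: the scaled differences are then the difference quotients at 0.\<close>

lemma initial_velocity_in_tangent_cone:
  assumes "v \<in> tensors ns" and "\<epsilon> > 0" and "\<gamma> ` {0..\<epsilon>} \<subseteq> M" and "has_initial_velocity \<gamma> \<epsilon> v"
  shows "v \<in> tangent_cone ns M (\<gamma> 0)"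
proof -
  \<comment> \<open>The successor keeps every sample time positive and at most
    \<open>\<epsilon>\<close>, including the one for \<open>k = 0\<close>.\<close>
  define h where "h k = \<epsilon> / real (Suc k)" for k
  have h: "h k > 0" "h k \<in> {0..\<epsilon>}" for k
    using \<open>\<epsilon> > 0\<close> by (simp_all add: h_def divide_le_eq)
  have "h \<longlonglongrightarrow> 0" unfolding h_def
    using LIMSEQ_Suc[OF lim_const_over_n[of \<epsilon>]] by simp
  then have h_lim: "filterlim h (at 0 within {0..\<epsilon>}) sequentially"
    unfolding filterlim_at using h by (auto simp: less_imp_neq[symmetric])
  have "((\<lambda>t. (\<gamma> t is - \<gamma> 0 is) / (t - 0)) \<longlongrightarrow> v is) (at 0 within {0..\<epsilon>})" for "is"
    using assms(4) unfolding has_initial_velocity_def has_field_derivative_iff by blast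
  from filterlim_compose[OF this h_lim]
  have quot: "(\<lambda>k. 1 / h k * (\<gamma> (h k) is - \<gamma> 0 is)) \<longlonglongrightarrow> v is" for "is" by simp
  \<comment> \<open>Convergence of the sample points to \<open>\<gamma> 0\<close> follows from that
    of the quotients, multiplied by \<open>h k\<close>.\<close>
  have "(\<lambda>k. h k * (1 / h k * (\<gamma> (h k) is - \<gamma> 0 is)) + \<gamma> 0 is) \<longlonglongrightarrow> 0 * v is + \<gamma> 0 is" for "is"
    by (intro tendsto_intros quot \<open>h \<longlonglongrightarrow> 0\<close>)
  moreover have "h k * (1 / h k * y) = y" for k y using h(1)[of k] by simp
  ultimately have "(\<lambda>k. \<gamma> (h k) is) \<longlonglongrightarrow> \<gamma> 0 is" for "is" by simp
  then show ?thesis using assms(1,3) h quot unfolding tangent_cone_def mem_Collect_eq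
    by (intro conjI exI[of _ "\<lambda>k. \<gamma> (h k)"] exI[of _ "\<lambda>k. 1 / h k"]) (auto simp: tendsto_fun_iff)
qed

theorem corollary19:
  fixes d :: nat and ns :: "nat list" and r :: "nat \<Rightarrow> nat" and A :: tensor
  assumes "d \<ge> 2"
    and "length ns = d"
    and "\<forall>n\<in>set ns. n > 0"
    and "A \<in> TT_variety ns r"
  shows "tangent_cone ns (TT_variety ns r) A =
    {v \<in> tensors ns. \<exists>\<epsilon>>0. \<exists>\<gamma>. analytic_arc_in (TT_variety ns r) \<epsilon> \<gamma> \<and>
       \<gamma> 0 = A \<and> has_initial_velocity \<gamma> \<epsilon> v}"
proof (intro equalityI subsetI)
  fix v assume v: "v \<in> tangent_cone ns (TT_variety ns r) A"
  have "A \<in> tensors ns" using assms(4) by (simp add: TT_variety_def)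
  moreover have "ns \<noteq> []" using assms(1,2) by auto
  ultimately obtain \<gamma> where \<gamma>: "\<And>t. \<gamma> t \<in> TT_variety ns r" "first_order_at A v \<gamma>"
    using polynomial_arc[OF _ _ v] by blast
  \<comment> \<open>The arc stays in the variety for all real \<open>t\<close>, so the choice
    \<open>\<epsilon> = 1\<close> is arbitrary.\<close>
  have "real_analytic_on (\<lambda>t. \<gamma> t is) {0..1} \<and> \<gamma> 0 is = A is \<and>
      ((\<lambda>t. \<gamma> t is) has_real_derivative v is) (at 0 within {0..1})" for "is"
  proof -
    obtain P where P: "(\<lambda>t. \<gamma> t is) = poly P" "poly P 0 = A is" "poly (pderiv P) 0 = v is"
      using first_order_at_polyE[OF \<gamma>(2), of "is"] by blast
    have "(poly P has_real_derivative v is) (at 0 within {0..1})"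
      using has_field_derivative_at_within[OF poly_DERIV[of P 0]] P(3) by simp
    moreover have "\<gamma> 0 is = A is" using fun_cong[OF P(1), of 0] P(2) by simp
    ultimately show ?thesis unfolding P(1) using real_analytic_on_poly by blast
  qed
  then have "analytic_arc_in (TT_variety ns r) 1 \<gamma> \<and> \<gamma> 0 = A \<and> has_initial_velocity \<gamma> 1 v"
    using \<gamma>(1) by (auto simp: analytic_arc_in_def has_initial_velocity_def)
  moreover have "v \<in> tensors ns" using v by (simp add: tangent_cone_def)
  ultimately show "v \<in> {v \<in> tensors ns. \<exists>\<epsilon>>0. \<exists>\<gamma>. analytic_arc_in (TT_variety ns r) \<epsilon> \<gamma> \<and>
       \<gamma> 0 = A \<and> has_initial_velocity \<gamma> \<epsilon> v}"
    by (intro CollectI conjI exI[of _ "1::real"] exI[of _ \<gamma>]) auto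
next
  fix v assume "v \<in> {v \<in> tensors ns. \<exists>\<epsilon>>0. \<exists>\<gamma>. analytic_arc_in (TT_variety ns r) \<epsilon> \<gamma> \<and>
       \<gamma> 0 = A \<and> has_initial_velocity \<gamma> \<epsilon> v}"
  then obtain \<epsilon> \<gamma> where "v \<in> tensors ns" "\<epsilon> > 0" "\<gamma> ` {0..\<epsilon>} \<subseteq> TT_variety ns r" "\<gamma> 0 = A"
    "has_initial_velocity \<gamma> \<epsilon> v"
    unfolding analytic_arc_in_def by blast
  then show "v \<in> tangent_cone ns (TT_variety ns r) A"
    using initial_velocity_in_tangent_cone[of v ns \<epsilon> \<gamma>] by simp
qed

end
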